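(* Let $\{\vec b_1,\ldots,\vec b_n\}$ be a basis for $\mathbb{F}_q^n$ as a vector space over $\mathbb{F}_q$. Given a nonzero word $\vec c\in\mathbb{F}_q^n$, let $m$ be the smallest index such that $\vec c\cdot\vec b_m\neq 0$. If there exists a vector space $V\subseteq\mathbb{F}_q^n$ of dimension $w$ such that for any $\vec v\in V\setminus\{\vec 0\}$ a word $\vec u\in\mathbb{F}_q^n$ exists with $$\vec v\ast\vec u\in\mathrm{Span}_{\mathbb{F}_q}\{\vec b_1,\ldots,\vec b_m\}\setminus\mathrm{Span}_{\mathbb{F}_q}\{\vec b_1,\ldots,\vec b_{m-1}\},$$ then $w_H(\vec c)\ge w$.
   Context: $\mathbb{F}_q$ is the finite field with $q$ elements, $w_H$ denotes Hamming weight, $\vec a\cdot\vec b=\sum_i a_ib_i$, and $\vec a\ast\vec b=(a_1b_1,\ldots,a_nb_n)$ is the componentwise product. *)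

theory Defs
  imports "HOL-Analysis.Cartesian_Space"
begin

(* Injectivity is required separately because the library notion of linear
   independence is a property of the set of basis vectors. *)
definition indexed_basis :: "(nat \<Rightarrow> 'a::field ^ 'n) \<Rightarrow> bool" where
  "indexed_basis b \<longleftrightarrow>
     inj_on b {1..CARD('n)} \<and>
     vec.independent (b ` {1..CARD('n)}) \<and>
     vec.span (b ` {1..CARD('n)}) = UNIV"

definition hamming_weight :: "'a::zero ^ 'n \<Rightarrow> nat" where
  "hamming_weight c = card {i. c $ i \<noteq> 0}"

end

theory Submission
  imports Defs
begin

text \<open>Every word of \<open>span {b 1, \<dots>, b m} - span {b 1, \<dots>, b (m - 1)}\<close> has nonzero product with
  \<open>c\<close>, since \<open>c\<close> is orthogonal to \<open>b 1, \<dots>, b (m - 1)\<close> but not to \<open>b m\<close>. So if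
  \<open>v * u\<close> is such a word, then \<open>c * v \<noteq> 0\<close>. Hence \<open>v \<mapsto> c * v\<close> embeds \<open>V\<close> into the space of
  words supported in the support of \<open>c\<close>, whose dimension is the weight of \<open>c\<close>.\<close>

lemma subspace_scalar_product_zero:
  "vec.subspace {x :: 'a::field ^ 'n. scalar_product c x = 0}"
  by (rule vec.subspaceI)
     (auto simp: scalar_product_def algebra_simps sum.distrib simp flip: sum_distrib_left)

lemma linear_times_left:
  "Vector_Spaces.linear (*s) (*s) ((*) (c :: 'a::field ^ 'n))"
  by unfold_locales (simp_all add: vec_eq_iff algebra_simps)

lemma dim_le_hamming_weight:
  fixes c :: "'a::field ^ 'n"
  assumes V: "vec.subspace V" and inj: "\<And>v. v \<in> V \<Longrightarrow> c * v = 0 \<Longrightarrow> v = 0"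
  shows "vec.dim V \<le> hamming_weight c"
proof -
  interpret mul: Vector_Spaces.linear "(*s)" "(*s)" "(*) c"
    by (rule linear_times_left)
  have "inj_on ((*) c) (vec.span V)"
    using inj V by (simp add: mul.inj_on_iff_eq_0 vec.span_eq_iff[THEN iffD2])
  then have "vec.dim V = vec.dim ((*) c ` V)"
    using vec.dim_image_eq[OF linear_times_left] by metis
  also have "\<dots> \<le> vec.dim {x :: 'a ^ 'n. \<forall>i. i \<notin> {i. c $ i \<noteq> 0} \<longrightarrow> x $ i = 0}"
    by (intro vec.dim_subset) auto
  also have "\<dots> = hamming_weight c"
    unfolding hamming_weight_def by (rule dim_substandard_cart)
  finally show ?thesis .
qed

theorem corollary7:
  fixes b :: "nat \<Rightarrow> 'a::{field,finite} ^ 'n"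
    and c :: "'a ^ 'n"
    and V :: "('a ^ 'n) set"
    and m w :: nat
  assumes "indexed_basis b"
    and "c \<noteq> 0"
    and "m = (LEAST i. i \<in> {1..CARD('n)} \<and> scalar_product c (b i) \<noteq> 0)"
    and "vec.subspace V"
    and "vec.dim V = w"
    and "\<And>v. v \<in> V - {0} \<Longrightarrow>
           \<exists>u. v * u \<in> vec.span (b ` {1..m}) - vec.span (b ` {1..<m})"
  shows "hamming_weight c \<ge> w"
proof -
  let ?K = "{x. scalar_product c x = 0}"
  let ?P = "\<lambda>i. i \<in> {1..CARD('n)} \<and> scalar_product c (b i) \<noteq> 0"
  \<comment> \<open>\<open>LEAST\<close> gives information about \<open>m\<close> only if some index
    qualifies. If none did, \<open>c\<close> would be orthogonal to a spanning set, hence to every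
    unit vector.\<close>
  have "\<exists>i. ?P i"
  proof (rule ccontr)
    assume "\<not> (\<exists>i. ?P i)"
    then have "vec.span (b ` {1..CARD('n)}) \<subseteq> ?K"
      by (intro vec.span_minimal subspace_scalar_product_zero) auto
    then have orth: "scalar_product c x = 0" for x
      using assms(1) by (auto simp: indexed_basis_def)
    have "c $ i = 0" for i
      using orth[of "axis i 1"]
      by (simp add: scalar_product_def axis_def if_distrib cong: if_cong)
    with assms(2) show False by (simp add: vec_eq_iff)
  qed
  then have m: "?P m"
    unfolding assms(3) by (rule LeastI_ex)
  \<comment> \<open>Indices from 1 below \<open>m\<close> stay in the range of the basis, so
    minimality of \<open>m\<close> applies to them.\<close>
  have "b ` {1..<m} \<subseteq> ?K"
    using m not_less_Least[of _ ?P, folded assms(3)] by force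
  then have below: "vec.span (b ` {1..<m}) \<subseteq> ?K"
    by (intro vec.span_minimal subspace_scalar_product_zero)
  have "v = 0" if v: "v \<in> V" and cv: "c * v = 0" for v
  proof (rule ccontr)
    assume "v \<noteq> 0"
    then obtain u where u: "v * u \<in> vec.span (b ` {1..m})" "v * u \<notin> vec.span (b ` {1..<m})"
      using assms(6) v by blast
    have "{1..m} = insert m {1..<m}"
      using m by auto
    \<comment> \<open>\<open>k\<close> is a coefficient of \<open>b m\<close> in
      \<open>v * u\<close>. Showing \<open>k = 0\<close> would put \<open>v * u\<close> in the
      smaller span, against the choice of \<open>u\<close>.\<close>
    then obtain k where k: "v * u - k *s b m \<in> vec.span (b ` {1..<m})"
      using u(1) by (auto simp: vec.span_breakdown_eq)
    \<comment> \<open>These are factors of the summands of \<open>scalar_product c (v * u)\<close>,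
      so that product vanishes for any \<open>u\<close>.\<close>
    have "c $ i * v $ i = 0" for i
      using cv by (metis vector_mult_component zero_index)
    then have "scalar_product c (v * u) = 0"
      unfolding scalar_product_def by (intro sum.neutral) auto
    moreover have "scalar_product c (v * u - k *s b m) = 0"
      using k below by blast
    ultimately have "k * scalar_product c (b m) = 0"
      by (simp add: scalar_product_def algebra_simps sum_subtractf sum_distrib_left)
    with m k u(2) show False by simp
  qed
  then show ?thesis
    using dim_le_hamming_weight assms(4,5) by blast
qed

end
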